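(* Let $\Omega\subset\mathbb{R}^2$ be a domain with smooth boundary $\partial\Omega$. If a continuous function $u:\Omega\to\mathbb{R}$ has the local median value property in $\Omega$, then $u$ is $1$-harmonic in $\Omega$ in the viscosity sense.
   Context: Notation: $B(x,r)$ is the ball (disc) in $\mathbb{R}^2$ with center $x$ and radius $r$, and $\partial B(x,r)$ is its boundary circle, equipped with arclength measure. Median: if $f$ is measurable with respect to $\mu$ and $E$ is a measurable set, $m \in \mathbb{R}$ is a median of $f$ over $E$ if and only if $\mu\{x\in E : f(x)\ge m\} \ge \mu(E)/2$ and $\mu\{x \in E : f(x)\le m\}\ge \mu(E)/2$. When $f$ is continuous on a circle $\partial B(x,r)$ (with arclength measure), the median is unique and is denoted $\operatorname{median}_{s\in\partial B(x,r)}\{f(s)\}$. Local median value property: a continuous function $u$ has the local median value property in $\Omega$ if there is a continuous function $R:\Omega\to\mathbb{R}$ with $0 < R(x) \le \operatorname{dist}(x,\partial\Omega)$ for all $x\in\Omega$ such that $$u(x) = \operatorname{median}_{s\in\partial B(x,r)}\{u(s)\}\quad\text{for all } x\in\Omega \text{ and } 0<r\le R(x),$$ where, for $u$ defined only on $\Omega$, the identity is required only for those $r$ with $\partial B(x,r)\subset\Omega$. $1$-Laplacian: for $\varphi\in C^2(\Omega)$ and a point where $D\varphi\neq 0$, $\Delta_1\varphi := |D\varphi|\operatorname{div}\left(\frac{D\varphi}{|D\varphi|}\right)$. Viscosity solutions of $-\Delta_1 u = 0$: a continuous function $\overline{u}:\Omega\to\mathbb{R}$ is a viscosity supersolution if and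 only if, whenever $x_0\in\Omega$ and $\varphi\in C^2(\Omega)$ satisfy $\overline{u}(x_0)=\varphi(x_0)$, $\overline{u}(x)>\varphi(x)$ for all $x\in\Omega$ with $x\ne x_0$, and $D\varphi(x_0)\ne 0$, one has $-\Delta_1\varphi(x_0)\ge 0$. A continuous function $\underline{u}$ is a viscosity subsolution if and only if $-\underline{u}$ is a viscosity supersolution. A continuous function $u$ is $1$-harmonic in the viscosity sense if it is both a viscosity subsolution and a viscosity supersolution. *)

theory Defs
  imports "HOL-Analysis.Analysis"
begin

section \<open>Differentiability classes and the 1-Laplacian\<close>

text \<open>On an open set \<open>S\<close> this is the usual class of functions whose partial derivatives up to
  order \<open>k\<close> exist and are continuous on \<open>S\<close>; the values of \<open>f\<close> outside \<open>S\<close> are irrelevant.\<close>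

primrec Ck_on :: "nat \<Rightarrow> ('a::euclidean_space \<Rightarrow> real) \<Rightarrow> 'a set \<Rightarrow> bool" where
  "Ck_on 0 f S \<longleftrightarrow> continuous_on S f"
| "Ck_on (Suc k) f S \<longleftrightarrow> (\<forall>x\<in>S. f differentiable (at x)) \<and>
     (\<forall>b\<in>Basis. Ck_on k (\<lambda>x. frechet_derivative f (at x) b) S)"

definition gradient :: "('a::euclidean_space \<Rightarrow> real) \<Rightarrow> 'a \<Rightarrow> 'a" where
  "gradient f x = (\<Sum>b\<in>Basis. frechet_derivative f (at x) b *\<^sub>R b)"

definition divergence :: "('a::euclidean_space \<Rightarrow> 'a) \<Rightarrow> 'a \<Rightarrow> real" where
  "divergence F x = (\<Sum>b\<in>Basis. frechet_derivative F (at x) b \<bullet> b)"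

definition laplacian1 :: "('a::euclidean_space \<Rightarrow> real) \<Rightarrow> 'a \<Rightarrow> real" where
  "laplacian1 f x =
     norm (gradient f x) * divergence (\<lambda>y. gradient f y /\<^sub>R norm (gradient f y)) x"


section \<open>Viscosity solutions of \<open>- \<Delta>\<^sub>1 u = 0\<close>\<close>

definition viscosity_supersolution :: "'a::euclidean_space set \<Rightarrow> ('a \<Rightarrow> real) \<Rightarrow> bool" where
  "viscosity_supersolution \<Omega> u \<longleftrightarrow> continuous_on \<Omega> u \<and>
     (\<forall>x0\<in>\<Omega>. \<forall>\<phi>. Ck_on 2 \<phi> \<Omega> \<and> u x0 = \<phi> x0 \<and> (\<forall>x\<in>\<Omega>. x \<noteq> x0 \<longrightarrow> u x > \<phi> x) \<and>
        gradient \<phi> x0 \<noteq> 0 \<longrightarrow> - laplacian1 \<phi> x0 \<ge> 0)"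

definition viscosity_subsolution :: "'a::euclidean_space set \<Rightarrow> ('a \<Rightarrow> real) \<Rightarrow> bool" where
  "viscosity_subsolution \<Omega> u \<longleftrightarrow> viscosity_supersolution \<Omega> (\<lambda>x. - u x)"

definition one_harmonic_viscosity :: "'a::euclidean_space set \<Rightarrow> ('a \<Rightarrow> real) \<Rightarrow> bool" where
  "one_harmonic_viscosity \<Omega> u \<longleftrightarrow> viscosity_subsolution \<Omega> u \<and> viscosity_supersolution \<Omega> u"


section \<open>Domains with smooth boundary\<close>

text \<open>Near each boundary point, after an orthogonal change of coordinates, \<open>\<Omega>\<close> is the part of a
  disc strictly above the graph of a \<open>C\<^sup>\<infinity>\<close> function of one variable.\<close>

definition smooth_boundary :: "(real^2) set \<Rightarrow> bool" where
  "smooth_boundary \<Omega> \<longleftrightarrow> (\<forall>p\<in>frontier \<Omega>. \<exists>r>0. \<exists>T :: real^2 \<Rightarrow> real^2. \<exists>\<gamma> :: real \<Rightarrow> real.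
     orthogonal_transformation T \<and> (\<forall>k. Ck_on k \<gamma> UNIV) \<and>
     \<Omega> \<inter> ball p r = {x \<in> ball p r. T x $ 2 > \<gamma> (T x $ 1)})"


section \<open>Medians\<close>

definition is_median :: "'a measure \<Rightarrow> 'a set \<Rightarrow> ('a \<Rightarrow> real) \<Rightarrow> real \<Rightarrow> bool" where
  "is_median M E f m \<longleftrightarrow> f \<in> borel_measurable M \<and> E \<in> sets M \<and>
     emeasure M {x\<in>E. f x \<ge> m} \<ge> emeasure M E / 2 \<and>
     emeasure M {x\<in>E. f x \<le> m} \<ge> emeasure M E / 2"

definition circle_param :: "real^2 \<Rightarrow> real \<Rightarrow> real \<Rightarrow> real^2" where
  "circle_param x r t = x + r *\<^sub>R vector [cos t, sin t]"

text \<open>Arclength on the circle, as the image of \<open>r dt\<close> on \<open>[0, 2\<pi>)\<close> under the angular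
  parametrisation. Its space is the circle itself, so measurability does not depend on values
  off the circle.\<close>

definition arclength_measure :: "real^2 \<Rightarrow> real \<Rightarrow> (real^2) measure" where
  "arclength_measure x r = scale_measure (ennreal r)
     (distr (restrict_space lborel {0..<2*pi}) (restrict_space borel (sphere x r))
        (circle_param x r))"

definition circle_median :: "(real^2 \<Rightarrow> real) \<Rightarrow> real^2 \<Rightarrow> real \<Rightarrow> real" where
  "circle_median f x r = (THE m. is_median (arclength_measure x r) (sphere x r) f m)"

text \<open>The bound \<open>R x \<le> dist(x, \<partial>\<Omega>)\<close> is stated pointwise over the boundary, so that the distance
  to an empty boundary counts as \<open>\<infinity>\<close> (whereas \<open>infdist x {} = 0\<close>).\<close>

definition local_median_value_property :: "(real^2) set \<Rightarrow> (real^2 \<Rightarrow> real) \<Rightarrow> bool" where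
  "local_median_value_property \<Omega> u \<longleftrightarrow> continuous_on \<Omega> u \<and>
     (\<exists>R :: real^2 \<Rightarrow> real. continuous_on \<Omega> R \<and>
        (\<forall>x\<in>\<Omega>. 0 < R x \<and> (\<forall>y\<in>frontier \<Omega>. R x \<le> dist x y)) \<and>
        (\<forall>x\<in>\<Omega>. \<forall>r. 0 < r \<and> r \<le> R x \<and> sphere x r \<subseteq> \<Omega> \<longrightarrow> u x = circle_median u x r))"


subsection \<open>Existence and uniqueness of the median on a circle\<close>

lemma circle_param_in_sphere: "r \<ge> 0 \<Longrightarrow> circle_param x r t \<in> sphere x r"
proof -
  assume r: "r \<ge> 0"
  have "norm (vector [cos t, sin t] :: real^2) = 1"
    by (simp add: norm_vec_def L2_set_def sum_2)
  then show ?thesis using r by (simp add: circle_param_def dist_norm)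
qed

lemma continuous_circle_param: "continuous_on S (circle_param x r)"
proof -
  have eq: "circle_param x r = (\<lambda>t. x + r *\<^sub>R (\<chi> i. if i = 1 then cos t else sin t))"
    by (auto simp: circle_param_def fun_eq_iff vec_eq_iff forall_2)
  have "continuous_on S (\<lambda>t. if (i::2) = 1 then cos t else sin (t::real))" for i
    by (cases "i = 1") (auto intro!: continuous_intros)
  then show ?thesis unfolding eq
    by (intro continuous_intros continuous_on_vec_lambda) auto
qed

lemma measurable_circle_param:
  assumes "r \<ge> 0"
  shows "circle_param x r \<in> restrict_space lborel {0..<2*pi} \<rightarrow>\<^sub>M restrict_space borel (sphere x r)"
proof (rule measurable_restrict_space2)
  show "circle_param x r \<in> space (restrict_space lborel {0..<2*pi}) \<rightarrow> sphere x r"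
    using circle_param_in_sphere[OF assms] by auto
  have "circle_param x r \<in> borel_measurable borel"
    using continuous_circle_param by (rule borel_measurable_continuous_onI)
  then show "circle_param x r \<in> borel_measurable (restrict_space lborel {0..<2*pi})"
    by (intro measurable_restrict_space1) simp
qed

lemma space_arclength [simp]: "space (arclength_measure x r) = sphere x r"
  by (simp add: arclength_measure_def space_restrict_space space_scale_measure)

lemma sets_arclength:
  "sets (arclength_measure x r) = sets (restrict_space borel (sphere x r))"
  by (simp add: arclength_measure_def)

lemma emeasure_arclength:
  assumes "r \<ge> 0" "A \<in> sets (arclength_measure x r)"
  shows "emeasure (arclength_measure x r) A =
    ennreal r * emeasure lborel {t \<in> {0..<2*pi}. circle_param x r t \<in> A}"
proof -
  have A: "A \<in> sets (restrict_space borel (sphere x r))"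
    using assms(2) by (simp add: sets_arclength)
  have "emeasure (arclength_measure x r) A = ennreal r * emeasure
      (restrict_space lborel {0..<2*pi}) (circle_param x r -` A \<inter> {0..<2*pi})"
    unfolding arclength_measure_def
    by (simp add: emeasure_distr[OF measurable_circle_param[OF assms(1)] A] space_restrict_space)
  also have "emeasure (restrict_space lborel {0..<2*pi}) (circle_param x r -` A \<inter> {0..<2*pi})
      = emeasure lborel (circle_param x r -` A \<inter> {0..<2*pi})"
    by (rule emeasure_restrict_space) auto
  also have "circle_param x r -` A \<inter> {0..<2*pi} = {t \<in> {0..<2*pi}. circle_param x r t \<in> A}"
    by auto
  finally show ?thesis .
qed

lemma emeasure_arclength_sphere:
  assumes "r \<ge> 0"
  shows "emeasure (arclength_measure x r) (sphere x r) = ennreal (2 * pi * r)"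
proof -
  have "sphere x r \<in> sets (arclength_measure x r)"
    using sets.top[of "arclength_measure x r"] by simp
  then have "emeasure (arclength_measure x r) (sphere x r) =
      ennreal r * emeasure lborel {t \<in> {0..<2*pi}. circle_param x r t \<in> sphere x r}"
    by (rule emeasure_arclength[OF assms])
  also have "{t \<in> {0..<2*pi}. circle_param x r t \<in> sphere x r} = {0..<2*pi}"
    using circle_param_in_sphere[OF assms] by blast
  finally show ?thesis
    using assms by (simp add: ennreal_mult'[symmetric] mult_ac)
qed

lemma measurable_arclength:
  fixes f :: "real^2 \<Rightarrow> real"
  assumes "continuous_on (sphere x r) f"
  shows "f \<in> borel_measurable (arclength_measure x r)"
proof -
  have "f \<in> borel_measurable (restrict_space borel (sphere x r))"
    using assms by (rule borel_measurable_continuous_on_restrict)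
  then show ?thesis
    using measurable_cong_sets[OF sets_arclength refl] by blast
qed

lemma ex_median_finite:
  assumes "finite_measure M" and f [measurable]: "f \<in> borel_measurable M"
    and pos: "measure M (space M) > 0" and bd: "\<And>x. x \<in> space M \<Longrightarrow> \<bar>f x\<bar> \<le> (C::real)"
  shows "\<exists>m. is_median M (space M) f m"
proof -
  interpret finite_measure M by fact
  define h where "h = measure M (space M) / 2"
  define S where "S = {m. measure M {x\<in>space M. f x \<ge> m} \<ge> h}"
  have h: "h > 0" using pos by (simp add: h_def)
  have "{x\<in>space M. f x \<ge> - C} = space M" using bd by (fastforce simp: abs_le_iff)
  then have ne: "- C \<in> S" using pos by (simp add: S_def h_def)
  have ub: "m \<le> C" if "m \<in> S" for m
  proof (rule ccontr)
    assume "\<not> m \<le> C"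
    then have "{x\<in>space M. f x \<ge> m} = {}" using bd by (fastforce simp: abs_le_iff)
    then show False using that h unfolding S_def by (metis (no_types, lifting) measure_empty mem_Collect_eq not_le)
  qed
  then have bdd: "bdd_above S" by (rule bdd_aboveI)
  define m where "m = Sup S"
  have down: "b \<in> S" if "a \<in> S" "b \<le> a" for a b
  proof -
    have "measure M {x\<in>space M. f x \<ge> a} \<le> measure M {x\<in>space M. f x \<ge> b}"
      using that(2) by (intro finite_measure_mono) auto
    then show ?thesis using that(1) by (auto simp: S_def)
  qed
  have below: "b \<in> S" if "b < m" for b
    using that ne bdd down unfolding m_def by (metis empty_iff less_cSup_iff less_imp_le)
  have above: "b \<notin> S" if "b > m" for b
    using that bdd cSup_upper unfolding m_def by (metis not_le)
  have eps: "inverse (real (Suc n)) > 0" for n by simp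
  have dec: "inverse (real (Suc k)) \<le> inverse (real (Suc n))" if "n \<le> k" for n k
    using that by (intro le_imp_inverse_le) auto
  have lim0: "a \<le> b" if "\<And>n. a \<le> b + inverse (real (Suc n))" for a b :: real
    using that by (meson field_le_epsilon less_imp_le order_trans add_left_mono reals_Archimedean)
  have 1: "measure M {x\<in>space M. f x \<ge> m} \<ge> h"
  proof -
    define A where "A n = {x\<in>space M. f x \<ge> m - inverse (real (Suc n))}" for n
    have "(\<lambda>n. measure M (A n)) \<longlonglongrightarrow> measure M (\<Inter>n. A n)"
    proof (rule finite_Lim_measure_decseq)
      show "range A \<subseteq> sets M" unfolding A_def by auto
      show "decseq A" unfolding A_def decseq_def
        by (intro allI impI subsetI; drule dec) (simp del: of_nat_Suc inverse_le_iff_le)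
    qed
    moreover have "measure M (A n) \<ge> h" for n
      using below[of "m - inverse (real (Suc n))"] eps[of n] unfolding A_def S_def by simp
    moreover have "(\<Inter>n. A n) = {x\<in>space M. f x \<ge> m}"
    proof (intro equalityI subsetI)
      fix x assume "x \<in> (\<Inter>n. A n)"
      then have *: "x \<in> A n" for n by blast
      have "m \<le> f x"
      proof (rule lim0)
        fix n show "m \<le> f x + inverse (real (Suc n))"
          using *[of n] unfolding A_def by simp
      qed
      then show "x \<in> {x\<in>space M. f x \<ge> m}" using *[of 0] by (simp add: A_def)
    next
      fix x assume "x \<in> {x\<in>space M. f x \<ge> m}"
      then show "x \<in> (\<Inter>n. A n)" using eps unfolding A_def
        by (auto intro: order_trans[rotated])
    qed
    ultimately show ?thesis by (metis LIMSEQ_le_const)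
  qed
  have 2: "measure M {x\<in>space M. f x \<le> m} \<ge> h"
  proof -
    define A where "A n = {x\<in>space M. f x \<le> m + inverse (real (Suc n))}" for n
    have "(\<lambda>n. measure M (A n)) \<longlonglongrightarrow> measure M (\<Inter>n. A n)"
    proof (rule finite_Lim_measure_decseq)
      show "range A \<subseteq> sets M" unfolding A_def by auto
      show "decseq A" unfolding A_def decseq_def
        by (intro allI impI subsetI; drule dec) (simp del: of_nat_Suc inverse_le_iff_le)
    qed
    moreover have "measure M (A n) \<ge> h" for n
    proof -
      let ?b = "m + inverse (real (Suc n))"
      have "measure M {x\<in>space M. f x \<ge> ?b} < h"
        using above[of ?b] eps[of n] unfolding S_def by simp
      moreover have "measure M (space M) \<le> measure M (A n \<union> {x\<in>space M. f x \<ge> ?b})"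
        by (intro finite_measure_mono) (auto simp: A_def)
      moreover have "\<dots> \<le> measure M (A n) + measure M {x\<in>space M. f x \<ge> ?b}"
        by (intro measure_Un_le) (auto simp: A_def)
      ultimately show ?thesis unfolding h_def by linarith
    qed
    moreover have "(\<Inter>n. A n) = {x\<in>space M. f x \<le> m}"
    proof (intro equalityI subsetI)
      fix x assume "x \<in> (\<Inter>n. A n)"
      then have *: "x \<in> A n" for n by blast
      have "f x \<le> m"
      proof (rule lim0)
        fix n show "f x \<le> m + inverse (real (Suc n))"
          using *[of n] unfolding A_def by simp
      qed
      then show "x \<in> {x\<in>space M. f x \<le> m}" using *[of 0] by (simp add: A_def)
    next
      fix x assume "x \<in> {x\<in>space M. f x \<le> m}"
      then show "x \<in> (\<Inter>n. A n)" using eps unfolding A_def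
        by (auto intro: order_trans)
    qed
    ultimately show ?thesis by (metis LIMSEQ_le_const)
  qed
  have half: "emeasure M (space M) / 2 = ennreal h"
    unfolding h_def emeasure_eq_measure
    by (metis divide_ennreal ennreal_numeral measure_nonneg zero_less_numeral)
  show ?thesis
    unfolding is_median_def half
    by (rule exI[of _ m]) (simp add: f 1 2 emeasure_eq_measure)
qed

lemma circle_median_unique:
  fixes f :: "real^2 \<Rightarrow> real"
  assumes "r > 0" and cont: "continuous_on (sphere x r) f"
    and a: "is_median (arclength_measure x r) (sphere x r) f a"
    and b: "is_median (arclength_measure x r) (sphere x r) f b"
  shows "a \<le> b"
proof (rule ccontr)
  assume "\<not> a \<le> b"
  then have ba: "b < a" by simp
  let ?M = "arclength_measure x r"
  let ?c = "circle_param x r"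
  have r0: "r \<ge> 0" using assms by simp
  have f [measurable]: "f \<in> borel_measurable ?M" using cont by (rule measurable_arclength)
  have top: "emeasure ?M (sphere x r) = ennreal (2 * pi * r)"
    by (rule emeasure_arclength_sphere[OF r0])
  interpret finite_measure ?M by (rule finite_measureI) (simp add: top)
  have mtop: "measure ?M (sphere x r) = 2 * pi * r"
    using top r0 by (simp add: measure_def)
  have half: "emeasure ?M (sphere x r) / 2 = ennreal (pi * r)"
    unfolding top using r0 by (simp add: divide_ennreal[of _ 2, simplified])
  define H where "H = {s\<in>sphere x r. f s \<ge> a}"
  define L where "L = {s\<in>sphere x r. f s \<le> b}"
  define G where "G = {s\<in>sphere x r. b < f s \<and> f s < a}"
  have "{s\<in>space ?M. f s \<ge> a} \<in> sets ?M" "{s\<in>space ?M. f s \<le> b} \<in> sets ?M"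
    "{s\<in>space ?M. b < f s \<and> f s < a} \<in> sets ?M" by measurable
  then have sets: "H \<in> sets ?M" "L \<in> sets ?M" "G \<in> sets ?M"
    by (simp_all add: H_def L_def G_def)
  have H: "measure ?M H \<ge> pi * r" and L: "measure ?M L \<ge> pi * r"
    proof -
    have "ennreal (pi * r) \<le> emeasure ?M H" "ennreal (pi * r) \<le> emeasure ?M L"
      using a b by (simp_all only: is_median_def half H_def L_def)
    then show "measure ?M H \<ge> pi * r" "measure ?M L \<ge> pi * r"
      by (simp_all add: emeasure_eq_measure)
  qed
  have "measure ?M (H \<union> L \<union> G) = measure ?M H + measure ?M L + measure ?M G"
    using sets ba by (subst finite_measure_Union; auto simp: H_def L_def G_def
      intro!: finite_measure_Union)
  moreover have "H \<union> L \<union> G = sphere x r" by (auto simp: H_def L_def G_def)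
  ultimately have "measure ?M G \<le> 0" using H L mtop by simp
  then have "emeasure ?M G = 0"
    by (simp add: emeasure_eq_measure measure_le_0_iff)
  then have G0: "emeasure lborel {t \<in> {0..<2*pi}. ?c t \<in> G} = 0"
    using emeasure_arclength[OF r0 sets(3)] \<open>r > 0\<close> by (auto simp: ennreal_eq_0_iff)
  have pir: "pi * r > 0" using \<open>r > 0\<close> by simp
  have nonempty: "\<exists>t\<in>{0..<2*pi}. ?c t \<in> A" if "A \<in> sets ?M" "measure ?M A \<ge> pi * r" for A
  proof (rule ccontr)
    assume "\<not> ?thesis"
    then have "{t \<in> {0..<2*pi}. ?c t \<in> A} = {}" by auto
    then have "emeasure ?M A = 0" using emeasure_arclength[OF r0 that(1)] by (metis emeasure_empty mult_zero_right)
    then show False using that(2) pir by (simp add: measure_def)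
  qed
  obtain s t where s: "s \<in> {0..<2*pi}" "f (?c s) \<ge> a" and t: "t \<in> {0..<2*pi}" "f (?c t) \<le> b"
    using nonempty[OF sets(1) H] nonempty[OF sets(2) L] by (auto simp: H_def L_def)
  define g where "g = (\<lambda>u. f (?c u))"
  have g: "continuous_on UNIV g"
    unfolding g_def
    by (rule continuous_on_compose2[OF cont continuous_circle_param])
      (use circle_param_in_sphere[OF r0] in blast)
  have "\<exists>v. v \<in> {0<..<2*pi} \<and> g v = (a + b) / 2"
  proof (cases "s \<le> t")
    case True
    have "\<exists>v\<ge>s. v \<le> t \<and> g v = (a+b)/2"
      using True s t ba g by (intro IVT2') (auto simp: g_def intro: continuous_on_subset)
    then obtain v where v: "s \<le> v" "v \<le> t" "g v = (a+b)/2" by blast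
    have "v \<noteq> s" using v(3) s ba by (auto simp: g_def)
    then show ?thesis using v s t by (intro exI[of _ v]) auto
  next
    case False
    have "\<exists>v\<ge>t. v \<le> s \<and> g v = (a+b)/2"
      using False s t ba g by (intro IVT') (auto simp: g_def intro: continuous_on_subset)
    then obtain v where v: "t \<le> v" "v \<le> s" "g v = (a+b)/2" by blast
    have "v \<noteq> t" using v(3) t ba by (auto simp: g_def)
    then show ?thesis using v s t by (intro exI[of _ v]) auto
  qed
  then obtain v where v: "v \<in> {0<..<2*pi}" "g v = (a + b) / 2" by blast
  define U where "U = {0<..<2*pi} \<inter> g -` {b<..<a}"
  have "open U" unfolding U_def
    using g by (intro open_Int open_greaterThanLessThan open_vimage)
  moreover have "v \<in> U" using v ba by (simp add: U_def)
  ultimately obtain e where e: "e > 0" "ball v e \<subseteq> U" by (meson open_contains_ball)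
  have "{v<..<v+e} \<subseteq> ball v e" by (auto simp: dist_real_def)
  moreover have "U \<subseteq> {t \<in> {0..<2*pi}. ?c t \<in> G}"
    using circle_param_in_sphere[OF r0] by (auto simp: U_def G_def g_def)
  ultimately have sub: "{v<..<v+e} \<subseteq> {t \<in> {0..<2*pi}. ?c t \<in> G}" using e(2) by blast
  have "{t \<in> {0..<2*pi}. ?c t \<in> G} = {0..<2*pi} \<inter> g -` {b<..<a}"
    using circle_param_in_sphere[OF r0] by (auto simp: G_def g_def)
  moreover have "{0..<2*pi} \<inter> g -` {b<..<a} \<in> sets lborel"
  proof (rule sets.Int)
    have "open (g -` {b<..<a})" using g by (intro open_vimage) auto
    then show "g -` {b<..<a} \<in> sets lborel" by simp
  qed simp
  ultimately have "emeasure lborel {v<..<v+e} \<le> 0"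
    using emeasure_mono[OF sub, of lborel] G0 by simp
  then show False using e(1) by simp
qed

lemma ex1_circle_median:
  fixes f :: "real^2 \<Rightarrow> real"
  assumes "r > 0" and cont: "continuous_on (sphere x r) f"
  shows "\<exists>!m. is_median (arclength_measure x r) (sphere x r) f m"
proof (rule ex_ex1I)
  let ?M = "arclength_measure x r"
  have r0: "r \<ge> 0" using assms by simp
  have top: "emeasure ?M (sphere x r) = ennreal (2 * pi * r)"
    by (rule emeasure_arclength_sphere[OF r0])
  have "compact (f ` sphere x r)" using cont by (intro compact_continuous_image) auto
  then obtain C where "\<forall>y\<in>f ` sphere x r. norm y \<le> C"
    using compact_imp_bounded bounded_iff by metis
  then have C: "\<bar>f s\<bar> \<le> C" if "s \<in> space ?M" for s using that by auto
  have fin: "finite_measure ?M" by (rule finite_measureI) (simp add: top)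
  have pos: "measure ?M (space ?M) > 0" using top assms(1) by (simp add: measure_def)
  show "\<exists>m. is_median ?M (sphere x r) f m"
    using ex_median_finite[OF fin measurable_arclength[OF cont] pos C] by simp
next
  show "a = b" if "is_median (arclength_measure x r) (sphere x r) f a"
    "is_median (arclength_measure x r) (sphere x r) f b" for a b
    using circle_median_unique[OF assms] that by (meson order_antisym)
qed

lemma circle_median_eq_iff:
  assumes "r > 0" "continuous_on (sphere x r) f"
  shows "circle_median f x r = m \<longleftrightarrow> is_median (arclength_measure x r) (sphere x r) f m"
  unfolding circle_median_def using ex1_circle_median[OF assms] by (metis the1_equality theI')

end

theory Submission
  imports Defs
begin

text \<open>Let \<open>\<phi>\<close> touch \<open>u\<close> from below at \<open>x\<close> with nonzero gradient and suppose \<open>\<Delta>\<^sub>1 \<phi> x > 0\<close>. In the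
  plane \<open>\<Delta>\<^sub>1 \<phi> x\<close> is the second derivative of \<open>\<phi>\<close> in the unit direction tangent to the level
  line. If \<open>\<phi> < \<phi> x\<close> at both ends of a short segment centred at \<open>x\<close>, then the directional
  derivative vanishes and the second directional derivative is negative somewhere on it; shrinking
  the segment would give \<open>\<Delta>\<^sub>1 \<phi> x \<le> 0\<close>. So for small \<open>r\<close> the set \<open>{u \<le> u x}\<close> on the circle
  contains no antipodal pair. Being closed, it has measure strictly less than one half of the
  circle, and \<open>u x\<close> is not a median. Applying this to \<open>- u\<close> gives the subsolution property.\<close>

section \<open>Second derivatives of \<open>C\<^sup>2\<close> functions\<close>

lemma frechet_derivative_eq_gradient:
  assumes "f differentiable (at x)"
  shows "frechet_derivative f (at x) v = gradient f x \<bullet> v"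
proof -
  interpret linear "frechet_derivative f (at x)"
    using assms by (rule linear_frechet_derivative)
  have "frechet_derivative f (at x) v = frechet_derivative f (at x) (\<Sum>b\<in>Basis. (v \<bullet> b) *\<^sub>R b)"
    by (simp add: euclidean_representation)
  also have "\<dots> = (\<Sum>b\<in>Basis. (v \<bullet> b) * frechet_derivative f (at x) b)"
    by (simp add: sum scale)
  finally show ?thesis
    by (simp add: gradient_def inner_sum_left mult.commute inner_commute[of v])
qed

lemma has_derivative_gradient:
  assumes "f differentiable (at x)"
  shows "(f has_derivative (\<lambda>v. gradient f x \<bullet> v)) (at x)"
proof -
  have "frechet_derivative f (at x) = (\<lambda>v. gradient f x \<bullet> v)"
    using frechet_derivative_eq_gradient[OF assms] by blast
  then show ?thesis
    using assms by (simp add: frechet_derivative_works)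
qed

lemma C2_on_differentiable:
  assumes "Ck_on 2 f S" "x \<in> S"
  shows "f differentiable (at x)"
  using assms by (simp add: numeral_2_eq_2)

text \<open>The sum over \<open>b\<close> is the Hessian of \<open>f\<close> applied to
  \<open>v\<close>: its component along \<open>b\<close> is the derivative of the partial derivative
  along \<open>b\<close> in the direction \<open>v\<close>.\<close>

lemma has_derivative_gradient_C2:
  fixes f :: "'a::euclidean_space \<Rightarrow> real"
  assumes "Ck_on 2 f S" "x \<in> S"
  shows "(gradient f has_derivative
    (\<lambda>v. \<Sum>b\<in>Basis. (gradient (\<lambda>y. frechet_derivative f (at y) b) x \<bullet> v) *\<^sub>R b)) (at x)"
proof -
  have "(\<lambda>y. frechet_derivative f (at y) b) differentiable (at x)" if "b \<in> Basis" for b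
    using assms that by (simp add: numeral_2_eq_2)
  then have "((\<lambda>y. \<Sum>b\<in>Basis. frechet_derivative f (at y) b *\<^sub>R b) has_derivative
    (\<lambda>v. \<Sum>b\<in>Basis. (gradient (\<lambda>y. frechet_derivative f (at y) b) x \<bullet> v) *\<^sub>R b)) (at x)"
    by (intro has_derivative_sum has_derivative_scaleR_left has_derivative_gradient)
  then show ?thesis
    by (simp add: gradient_def[abs_def])
qed

lemma gradient_differentiable:
  fixes f :: "'a::euclidean_space \<Rightarrow> real"
  assumes "Ck_on 2 f S" "x \<in> S"
  shows "gradient f differentiable (at x)"
  using has_derivative_gradient_C2[OF assms] by (rule differentiableI)

text \<open>Joint continuity of the Hessian in base point and direction, read off from the
  continuity of its entries. Both arguments vary in the compactness argument below.\<close>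

lemma tendsto_frechet_derivative_gradient:
  fixes f :: "'a::euclidean_space \<Rightarrow> real"
  assumes f: "Ck_on 2 f S" and "open S" "x \<in> S"
    and X: "X \<longlonglongrightarrow> x" and V: "V \<longlonglongrightarrow> v" and XS: "\<And>n. X n \<in> S"
  shows "(\<lambda>n. frechet_derivative (gradient f) (at (X n)) (V n))
    \<longlonglongrightarrow> frechet_derivative (gradient f) (at x) v"
proof -
  have "continuous_on S (\<lambda>x. frechet_derivative (\<lambda>y. frechet_derivative f (at y) b) (at x) c)"
    if "b \<in> Basis" "c \<in> Basis" for b c
    using f that by (simp add: numeral_2_eq_2)
  then have "continuous (at x) (\<lambda>x. frechet_derivative (\<lambda>y. frechet_derivative f (at y) b) (at x) c)"
    if "b \<in> Basis" "c \<in> Basis" for b c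
    using that assms(2,3) by (simp add: continuous_on_eq_continuous_at)
  then have "(\<lambda>n. frechet_derivative (\<lambda>y. frechet_derivative f (at y) b) (at (X n)) c)
      \<longlonglongrightarrow> frechet_derivative (\<lambda>y. frechet_derivative f (at y) b) (at x) c"
    if "b \<in> Basis" "c \<in> Basis" for b c
    using that X isCont_tendsto_compose by blast
  then have "(\<lambda>n. gradient (\<lambda>y. frechet_derivative f (at y) b) (X n))
      \<longlonglongrightarrow> gradient (\<lambda>y. frechet_derivative f (at y) b) x" if "b \<in> Basis" for b
    using that unfolding gradient_def by (intro tendsto_intros)
  then have "(\<lambda>n. \<Sum>b\<in>Basis. (gradient (\<lambda>y. frechet_derivative f (at y) b) (X n) \<bullet> V n) *\<^sub>R b)
      \<longlonglongrightarrow> (\<Sum>b\<in>Basis. (gradient (\<lambda>y. frechet_derivative f (at y) b) x \<bullet> v) *\<^sub>R b)"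
    using V by (intro tendsto_intros)
  moreover have "frechet_derivative (gradient f) (at y) =
      (\<lambda>v. \<Sum>b\<in>Basis. (gradient (\<lambda>y. frechet_derivative f (at y) b) y \<bullet> v) *\<^sub>R b)"
    if "y \<in> S" for y
    using frechet_derivative_at[OF has_derivative_gradient_C2[OF f that]] by (rule sym)
  ultimately show ?thesis
    using XS \<open>x \<in> S\<close> by simp
qed

section \<open>The 1-Laplacian as a tangential second derivative\<close>

text \<open>\<open>D\<close> is the Hessian. The quotient rule for \<open>G / norm G\<close>, with
  \<open>D v \<bullet> sgn G\<close> as the derivative of the norm, gives a divergence whose product
  with \<open>norm G\<close> is the trace minus the second derivative in the direction of the
  gradient.\<close>

lemma laplacian1_eq_trace:
  fixes f :: "'a::euclidean_space \<Rightarrow> real"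
  assumes "(gradient f has_derivative D) (at x)" and G: "gradient f x \<noteq> 0"
  shows "laplacian1 f x = (\<Sum>b\<in>Basis. D b \<bullet> b)
    - D (gradient f x) \<bullet> gradient f x / (norm (gradient f x))\<^sup>2"
proof -
  let ?G = "gradient f x"
  interpret D: bounded_linear D
    using assms(1) by (rule has_derivative_bounded_linear)
  have "((\<lambda>y. norm (gradient f y)) has_derivative (\<lambda>v. D v \<bullet> sgn ?G)) (at x)"
    using has_derivative_compose[OF assms(1) has_derivative_norm[OF G]] .
  then have "((\<lambda>y. gradient f y /\<^sub>R norm (gradient f y)) has_derivative
      (\<lambda>v. D v /\<^sub>R norm ?G - ((D v \<bullet> ?G) / norm ?G ^ 3) *\<^sub>R ?G)) (at x)"
    using assms
    by (auto intro!: derivative_eq_intros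
        simp: sgn_div_norm power3_eq_cube divide_inverse algebra_simps fun_eq_iff)
  then have "divergence (\<lambda>y. gradient f y /\<^sub>R norm (gradient f y)) x =
      (\<Sum>b\<in>Basis. (D b /\<^sub>R norm ?G - ((D b \<bullet> ?G) / norm ?G ^ 3) *\<^sub>R ?G) \<bullet> b)"
    by (simp add: divergence_def frechet_derivative_at[symmetric])
  \<comment> \<open>The coefficients \<open>?G \<bullet> b\<close> are attached to
    \<open>D b\<close>, so that linearity turns the last sum into \<open>D ?G\<close>; symmetry of
    \<open>D\<close> does not enter.\<close>
  also have "\<dots> = (\<Sum>b\<in>Basis. D b \<bullet> b) / norm ?G - (\<Sum>b\<in>Basis. (?G \<bullet> b) *\<^sub>R D b) \<bullet> ?G / norm ?G ^ 3"
    by (simp add: inner_diff_left sum_subtractf sum_divide_distrib inner_sum_left mult.commute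
        divide_inverse_commute sum_distrib_left mult.left_commute)
  also have "(\<Sum>b\<in>Basis. (?G \<bullet> b) *\<^sub>R D b) = D (\<Sum>b\<in>Basis. (?G \<bullet> b) *\<^sub>R b)"
    by (simp add: D.sum D.scaleR)
  finally show ?thesis
    using G by (simp add: laplacian1_def euclidean_representation right_diff_distrib
        power3_eq_cube power2_eq_square)
qed

text \<open>In the plane the trace is the sum of the quadratic form over any orthonormal pair. If
  \<open>w\<close> completes \<open>v\<close> to such a pair, the gradient is parallel to
  \<open>w\<close>, so the subtracted normal term is exactly \<open>D w \<bullet> w\<close>.\<close>

lemma laplacian1_eq_tangential:
  fixes f :: "real^2 \<Rightarrow> real"
  assumes D: "(gradient f has_derivative D) (at x)" and "gradient f x \<noteq> 0"
    and v: "norm v = 1" "gradient f x \<bullet> v = 0"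
  shows "laplacian1 f x = D v \<bullet> v"
proof -
  \<comment> \<open>\<open>w\<close> is \<open>v\<close> rotated by a quarter turn.\<close>
  define w :: "real^2" where "w = vector [- v $ 2, v $ 1]"
  define l where "l = gradient f x \<bullet> w"
  interpret D: bounded_linear D
    using D by (rule has_derivative_bounded_linear)
  have v1: "v $ 1 * v $ 1 + v $ 2 * v $ 2 = 1"
    using v(1) by (simp add: norm_eq_1 inner_vec_def sum_2)
  have G: "gradient f x = l *\<^sub>R w"
  proof -
    have *: "gradient f x $ 1 * v $ 1 + gradient f x $ 2 * v $ 2 = 0"
      using v(2) by (simp add: inner_vec_def sum_2)
    have "gradient f x $ 1 = l * (- v $ 2)" "gradient f x $ 2 = l * v $ 1"
      using * v1 unfolding l_def w_def inner_vec_def sum_2 by (simp; algebra)+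
    then show ?thesis
      by (simp add: vec_eq_iff forall_2 w_def)
  qed
  have w: "w \<bullet> w = 1"
    using v1 by (simp add: w_def inner_vec_def sum_2)
  have "l \<noteq> 0" using G assms(2) by auto
  then have "D (gradient f x) \<bullet> gradient f x / (norm (gradient f x))\<^sup>2 = D w \<bullet> w"
    using w by (simp add: G D.scaleR power2_eq_square norm_eq_1[symmetric])
  moreover have "(\<Sum>b\<in>Basis. D b \<bullet> b) = D v \<bullet> v + D w \<bullet> w"
  proof -
    have exp: "D z = z $ 1 *\<^sub>R D (axis 1 1) + z $ 2 *\<^sub>R D (axis 2 1)" for z
    proof -
      have "z = z $ 1 *\<^sub>R axis 1 1 + z $ 2 *\<^sub>R axis 2 1"
        by (simp add: vec_eq_iff forall_2 axis_def)
      then show ?thesis by (metis D.add D.scaleR)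
    qed
    have "(\<Sum>b\<in>Basis. D b \<bullet> b) = D (axis 1 1) $ 1 + D (axis 2 1) $ 2"
      by (simp add: Basis_vec_def sum.UNION_disjoint axis_eq_axis UNIV_2 inner_axis)
    \<comment> \<open>The off-diagonal entries cancel because
      \<open>w $ 1 * w $ 2 = - (v $ 1 * v $ 2)\<close>.\<close>
    moreover have "D v \<bullet> v + D w \<bullet> w = (v $ 1 * v $ 1 + v $ 2 * v $ 2) * (D (axis 1 1) $ 1 + D (axis 2 1) $ 2)"
      unfolding exp[of v] exp[of w]
      by (simp add: w_def inner_vec_def sum_2 algebra_simps)
    ultimately show ?thesis using v1 by simp
  qed
  ultimately show ?thesis
    using laplacian1_eq_trace[OF D assms(2)] by simp
qed

section \<open>Segments with both ends in a sublevel set\<close>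

text \<open>Along the segment the directional derivative is positive somewhere before the centre and
  negative somewhere after it. The intermediate value theorem then gives \<open>y\<close>, and the
  mean value theorem for the derivative gives \<open>z\<close>. The two points may differ, since
  only their distance to \<open>x\<close> matters later.\<close>

lemma antipodal_sublevel_derivatives:
  fixes f :: "'a::euclidean_space \<Rightarrow> real"
  assumes f: "Ck_on 2 f S" and "cball x r \<subseteq> S" "norm v = 1" "r > 0"
    and less: "f (x + r *\<^sub>R v) < f x" "f (x - r *\<^sub>R v) < f x"
  obtains y z where "y \<in> cball x r" "z \<in> cball x r" "gradient f y \<bullet> v = 0"
    "frechet_derivative (gradient f) (at z) v \<bullet> v < 0"
proof -
  define p where "p s = x + s *\<^sub>R v" for s
  have p: "p s \<in> cball x r" if "-r \<le> s" "s \<le> r" for s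
    using that assms(3) by (simp add: p_def dist_norm)
  have pd: "(p has_derivative (\<lambda>h. h *\<^sub>R v)) (at s)" for s
    unfolding p_def by (auto intro!: derivative_eq_intros)
  have d1: "((\<lambda>s. f (p s)) has_real_derivative gradient f (p s) \<bullet> v) (at s)"
    if "-r \<le> s" "s \<le> r" for s
  proof -
    have "f differentiable (at (p s))"
      using C2_on_differentiable[OF f] p[OF that] assms(2) by blast
    from has_derivative_compose[OF pd has_derivative_gradient[OF this]]
    show ?thesis
      unfolding has_field_derivative_def
      by (rule has_derivative_eq_rhs) (simp add: fun_eq_iff mult.commute)
  qed
  have d2: "((\<lambda>s. gradient f (p s) \<bullet> v) has_real_derivative
      frechet_derivative (gradient f) (at (p s)) v \<bullet> v) (at s)" if "-r \<le> s" "s \<le> r" for s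
  proof -
    have d: "gradient f differentiable (at (p s))"
      using gradient_differentiable[OF f] p[OF that] assms(2) by blast
    interpret linear "frechet_derivative (gradient f) (at (p s))"
      using d by (rule linear_frechet_derivative)
    have "((\<lambda>s. gradient f (p s)) has_derivative
        (\<lambda>h. frechet_derivative (gradient f) (at (p s)) (h *\<^sub>R v))) (at s)"
      using has_derivative_compose[OF pd d[unfolded frechet_derivative_works]] .
    then have "((\<lambda>s. gradient f (p s) \<bullet> v) has_derivative
        (\<lambda>h. frechet_derivative (gradient f) (at (p s)) (h *\<^sub>R v) \<bullet> v)) (at s)"
      by (rule has_derivative_inner_left)
    then show ?thesis
      unfolding has_field_derivative_def
      by (rule has_derivative_eq_rhs) (simp add: fun_eq_iff scale mult.commute)
  qed
  \<comment> \<open>The mean value theorem is applied to the two halves of the segment separately;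
    the centre value exceeds both end values, which fixes the signs at \<open>b\<close> and
    \<open>a\<close>.\<close>
  have "\<exists>b. -r < b \<and> b < 0 \<and> f (p 0) - f (p (-r)) = (0 - (-r)) * (gradient f (p b) \<bullet> v)"
    using \<open>r > 0\<close> d1 by (intro MVT2) auto
  then obtain b where b: "-r < b" "b < 0" "f x - f (x - r *\<^sub>R v) = r * (gradient f (p b) \<bullet> v)"
    by (auto simp: p_def)
  then have b': "gradient f (p b) \<bullet> v > 0"
    using less(2) \<open>r > 0\<close> by (metis diff_gt_0_iff_gt zero_less_mult_pos)
  have "\<exists>a. 0 < a \<and> a < r \<and> f (p r) - f (p 0) = (r - 0) * (gradient f (p a) \<bullet> v)"
    using \<open>r > 0\<close> d1 by (intro MVT2) auto
  then obtain a where a: "0 < a" "a < r" "f (x + r *\<^sub>R v) - f x = r * (gradient f (p a) \<bullet> v)"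
    by (auto simp: p_def)
  then have a': "gradient f (p a) \<bullet> v < 0"
    using less(1) \<open>r > 0\<close> by (metis diff_less_0_iff_less mult_less_0_iff not_less_iff_gr_or_eq)
  have "\<exists>t\<ge>b. t \<le> a \<and> gradient f (p t) \<bullet> v = 0"
    using a a' b b' d2 by (intro IVT2') (auto intro!: continuous_at_imp_continuous_on DERIV_isCont[OF d2])
  then obtain t where t: "b \<le> t" "t \<le> a" "gradient f (p t) \<bullet> v = 0" by blast
  have "\<exists>s. b < s \<and> s < a \<and> gradient f (p a) \<bullet> v - gradient f (p b) \<bullet> v
      = (a - b) * (frechet_derivative (gradient f) (at (p s)) v \<bullet> v)"
    using a b d2 by (intro MVT2) auto
  then obtain s where s: "b < s" "s < a" "gradient f (p a) \<bullet> v - gradient f (p b) \<bullet> v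
      = (a - b) * (frechet_derivative (gradient f) (at (p s)) v \<bullet> v)" by blast
  have "(a - b) * (frechet_derivative (gradient f) (at (p s)) v \<bullet> v) < 0"
    using s(3) a' b' by linarith
  then have "frechet_derivative (gradient f) (at (p s)) v \<bullet> v < 0"
    using a b by (simp add: mult_less_0_iff)
  with that[of "p t" "p s"] p t s a b show ?thesis by simp
qed

text \<open>The bound \<open>e\<close> is uniform in the direction \<open>v\<close>, which is why
  compactness of the unit circle is needed: bad segments shrinking to \<open>x\<close> have
  directions accumulating at a unit vector tangent to the level line, along which the second
  derivative is at most 0.\<close>

lemma no_antipodal_sublevel:
  fixes f :: "real^2 \<Rightarrow> real"
  assumes f: "Ck_on 2 f S" and S: "open S" "x \<in> S" and G: "gradient f x \<noteq> 0"
    and pos: "laplacian1 f x > 0"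
  obtains e where "e > 0"
    "\<And>r v. \<lbrakk>0 < r; r < e; norm v = 1\<rbrakk> \<Longrightarrow> f x \<le> f (x + r *\<^sub>R v) \<or> f x \<le> f (x - r *\<^sub>R v)"
proof (rule ccontr)
  note D = gradient_differentiable[OF f]
  assume "\<not> thesis"
  with that have bad: "\<exists>r v. 0 < r \<and> r < e \<and> norm v = 1 \<and>
      f (x + r *\<^sub>R v) < f x \<and> f (x - r *\<^sub>R v) < f x" if "e > 0" for e
    using \<open>e > 0\<close> by (meson not_le)
  obtain d where d: "d > 0" "cball x d \<subseteq> S"
    using S open_contains_cball by blast
  have near: "\<exists>y z v. dist x y < e \<and> dist x z < e \<and> y \<in> S \<and> z \<in> S \<and> norm v = 1 \<and>
      gradient f y \<bullet> v = 0 \<and> frechet_derivative (gradient f) (at z) v \<bullet> v < 0"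
    if "e > 0" for e
  proof -
    \<comment> \<open>The bound by \<open>d\<close> keeps the whole ball around the segment inside
      \<open>S\<close>.\<close>
    obtain r v where r: "0 < r" "r < min e d" "norm v = 1"
        "f (x + r *\<^sub>R v) < f x" "f (x - r *\<^sub>R v) < f x"
      using bad[of "min e d"] \<open>e > 0\<close> d(1) by auto
    have "cball x r \<subseteq> S" using r(2) d(2) by auto
    from antipodal_sublevel_derivatives[OF f this r(3,1,4,5)]
    obtain y z where "y \<in> cball x r" "z \<in> cball x r" "gradient f y \<bullet> v = 0"
      "frechet_derivative (gradient f) (at z) v \<bullet> v < 0" .
    then show ?thesis using r \<open>cball x r \<subseteq> S\<close>
      by (intro exI[of _ y] exI[of _ z] exI[of _ v]) auto
  qed
  have "\<forall>n. \<exists>y z v. dist x y < inverse (real (Suc n)) \<and> dist x z < inverse (real (Suc n)) \<and>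
      y \<in> S \<and> z \<in> S \<and> norm v = 1 \<and>
      gradient f y \<bullet> v = 0 \<and> frechet_derivative (gradient f) (at z) v \<bullet> v < 0"
    by (intro allI near) simp
  then have "\<exists>Y Z V. \<forall>n. dist x (Y n) < inverse (real (Suc n)) \<and>
      dist x (Z n) < inverse (real (Suc n)) \<and> Y n \<in> S \<and> Z n \<in> S \<and> norm (V n) = 1 \<and>
      gradient f (Y n) \<bullet> V n = 0 \<and> frechet_derivative (gradient f) (at (Z n)) (V n) \<bullet> V n < 0"
    by (simp only: choice_iff)
  then obtain Y Z V where YZV: "\<forall>n. dist x (Y n) < inverse (real (Suc n)) \<and>
      dist x (Z n) < inverse (real (Suc n)) \<and> Y n \<in> S \<and> Z n \<in> S \<and> norm (V n) = 1 \<and>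
      gradient f (Y n) \<bullet> V n = 0 \<and> frechet_derivative (gradient f) (at (Z n)) (V n) \<bullet> V n < 0"
    by (elim exE)
  then have YZ: "\<And>n. dist x (Y n) < inverse (real (Suc n))" "\<And>n. dist x (Z n) < inverse (real (Suc n))"
      "\<And>n. Y n \<in> S" "\<And>n. Z n \<in> S"
    and V: "\<And>n. norm (V n) = 1" "\<And>n. gradient f (Y n) \<bullet> V n = 0"
      "\<And>n. frechet_derivative (gradient f) (at (Z n)) (V n) \<bullet> V n < 0"
    by - (elim allE conjE, assumption)+
  have lim: "X \<longlonglongrightarrow> x" if "\<And>n. dist x (X n) < inverse (real (Suc n))" for X
  proof (rule iffD2[OF tendsto_dist_iff], rule tendsto_sandwich[OF _ _ tendsto_const LIMSEQ_inverse_real_of_nat])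
    show "\<forall>\<^sub>F n in sequentially. dist (X n) x \<le> inverse (real (Suc n))"
      using that by (intro always_eventually allI less_imp_le) (metis dist_commute)
  qed simp
  have "Y \<longlonglongrightarrow> x" "Z \<longlonglongrightarrow> x"
    by (rule lim, rule YZ)+
  \<comment> \<open>\<open>Y\<close> and \<open>Z\<close> converge by themselves; only the
    directions require a subsequence.\<close>
  obtain v k where v: "v \<in> sphere 0 1" "strict_mono k" "(V \<circ> k) \<longlonglongrightarrow> v"
  proof (rule seq_compactE)
    show "seq_compact (sphere (0::real^2) 1)"
      by (rule compact_imp_seq_compact[OF compact_sphere])
  qed (use V(1) in auto)
  have Yk: "(\<lambda>n. Y (k n)) \<longlonglongrightarrow> x" and Zk: "(\<lambda>n. Z (k n)) \<longlonglongrightarrow> x"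
    using LIMSEQ_subseq_LIMSEQ[OF _ v(2)] \<open>Y \<longlonglongrightarrow> x\<close> \<open>Z \<longlonglongrightarrow> x\<close> by (auto simp: o_def)
  have Vk: "(\<lambda>n. V (k n)) \<longlonglongrightarrow> v" using v(3) by (simp add: o_def)
  have "isCont (gradient f) x"
    using D[OF S(2)] by (rule differentiable_imp_continuous_within)
  from tendsto_inner[OF isCont_tendsto_compose[OF this Yk] Vk]
  have "gradient f x \<bullet> v = 0"
    by (simp add: V(2) LIMSEQ_const_iff)
  moreover have "(\<lambda>n. frechet_derivative (gradient f) (at (Z (k n))) (V (k n)) \<bullet> V (k n))
      \<longlonglongrightarrow> frechet_derivative (gradient f) (at x) v \<bullet> v"
    by (rule tendsto_inner[OF tendsto_frechet_derivative_gradient[OF f S Zk Vk] Vk]) (rule YZ)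
  \<comment> \<open>The strict inequality becomes weak in the limit, which still contradicts the
    strict positivity of \<open>laplacian1 f x\<close>.\<close>
  then have "frechet_derivative (gradient f) (at x) v \<bullet> v \<le> 0"
    by (rule LIMSEQ_le_const2) (use V(3) less_imp_le in blast)
  moreover have "norm v = 1" using v(1) by simp
  ultimately show False
    using laplacian1_eq_tangential[OF D[OF S(2), unfolded frechet_derivative_works] G, of v] pos
    by simp
qed

section \<open>Antipodal points and medians on circles\<close>

text \<open>Folding the second half period onto the first turns the sublevel set into two disjoint
  subsets of \<open>{0..<pi}\<close>, so its measure is at most \<open>pi\<close>. The inequality is
  strict because both subsets miss a nonempty open set \<open>P\<close> of angles at which
  \<open>g\<close> is positive at both antipodal points.\<close>

lemma emeasure_antipodal_free:
  fixes g :: "real \<Rightarrow> real"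
  assumes g: "continuous_on UNIV g" and per: "\<And>t. g (t + 2 * pi) = g t"
    and antipodal: "\<And>t. g t > 0 \<or> g (t + pi) > 0"
  shows "emeasure lborel {t \<in> {0..<2*pi}. g t \<le> 0} < ennreal pi"
proof -
  have g': "continuous_on A (\<lambda>t. g (t + c))" for A c
    by (rule continuous_on_compose2[OF g]) (auto intro!: continuous_intros)
  \<comment> \<open>By periodicity \<open>g t - g (t + pi)\<close> takes opposite values at
    \<open>0\<close> and \<open>pi\<close>.\<close>
  have "\<exists>t\<in>{0..pi}. g t = g (t + pi)"
  proof -
    have c: "continuous_on {0..pi} (\<lambda>t. g t - g (t + pi))"
      using g'[of "{0..pi}" 0] by (intro continuous_on_diff g') simp
    have pi2: "g (pi + pi) = g 0" using per[of 0] by (simp only: mult_2 add_0)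
    have "\<exists>t\<ge>0. t \<le> pi \<and> g t - g (t + pi) = 0"
    proof (cases "g 0 \<le> g pi")
      case True
      then show ?thesis using pi2 by (intro IVT' c) auto
    next
      case False
      then show ?thesis using pi2 by (intro IVT2' c) auto
    qed
    then show ?thesis by auto
  qed
  \<comment> \<open>One of the two equal values is positive, hence both are.\<close>
  then obtain t0 where t0: "t0 \<in> {0..pi}" "g t0 > 0" "g (t0 + pi) > 0"
    using antipodal by metis
  define P where "P = {t. g t > 0 \<and> g (t + pi) > 0}"
  have "open P"
  proof -
    have "open {t. g (t + c) > 0}" for c
      using g'[of UNIV c] by (intro open_Collect_less) auto
    from open_Int[OF this[of 0] this[of pi]] show ?thesis
      by (simp add: P_def Collect_conj_eq)
  qed
  \<comment> \<open>\<open>t0\<close> may be an endpoint; openness of \<open>P\<close> allows a move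
    into the interior, where a whole ball fits.\<close>
  moreover have "t0 \<in> closure {0<..<pi}" "t0 \<in> P"
    using t0 by (auto simp: P_def)
  ultimately have "P \<inter> {0<..<pi} \<noteq> {}"
    by (metis IntI empty_iff open_Int_closure_eq_empty)
  then obtain t1 where "t1 \<in> P \<inter> {0<..<pi}" by blast
  moreover have "open (P \<inter> {0<..<pi})" using \<open>open P\<close> by auto
  ultimately obtain e where e: "e > 0" "ball t1 e \<subseteq> P \<inter> {0<..<pi}"
    by (meson open_contains_ball)
  have ball: "emeasure lborel (ball t1 e) = ennreal (2 * e)"
    using e(1) by (simp add: ball_eq_greaterThanLessThan)
  define A where "A = {t \<in> {0..<pi}. g t \<le> 0}"
  define B where "B = {t \<in> {0..<pi}. g (t + pi) \<le> 0}"
  have "closed {t. g (t + c) \<le> 0}" for c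
    using g'[of UNIV c] by (intro closed_Collect_le) auto
  then have "{0..<pi} \<inter> {t. g (t + c) \<le> 0} \<in> sets lborel" for c
    by (intro sets.Int) auto
  from this[of 0] this[of pi] have sets: "A \<in> sets lborel" "B \<in> sets lborel"
    by (auto simp: A_def B_def Int_def)
  have [simp]: "emeasure lborel {0..<pi} = ennreal pi" by simp
  \<comment> \<open>\<open>B\<close> is the part in the second half period shifted back by
    \<open>pi\<close>; translation invariance of Lebesgue measure undoes the shift.\<close>
  have "{t \<in> {0..<2*pi}. g t \<le> 0} = A \<union> (+) pi ` B"
  proof (intro equalityI subsetI)
    fix t assume t: "t \<in> {t \<in> {0..<2*pi}. g t \<le> 0}"
    show "t \<in> A \<union> (+) pi ` B"
    proof (cases "t < pi")
      case False
      then have "t - pi \<in> B" using t by (simp add: B_def)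
      then show ?thesis by (intro UnI2 image_eqI[of _ _ "t - pi"]) auto
    qed (use t in \<open>simp add: A_def\<close>)
  qed (auto simp: A_def B_def add.commute)
  moreover have "(+) pi ` B \<in> sets lborel" "emeasure lborel ((+) pi ` B) = emeasure lborel B"
  proof -
    have *: "(+) pi ` B = (\<lambda>t. - pi + t) -` B"
      by (auto intro!: image_eqI[of _ _ "_ - pi"])
    have m: "(\<lambda>t. - pi + t) \<in> measurable lborel lborel" by simp
    show "(+) pi ` B \<in> sets lborel"
      unfolding * using measurable_sets[OF m sets(2)]
      by (simp only: space_lborel space_borel Int_UNIV_right)
    have "emeasure lborel B = emeasure (distr lborel borel ((+) (- pi))) B"
      by (simp add: lborel_distr_plus)
    also have "\<dots> = emeasure lborel ((+) (- pi) -` B)"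
      using sets(2) by (subst emeasure_distr) auto
    finally show "emeasure lborel ((+) pi ` B) = emeasure lborel B"
      unfolding * by (rule sym)
  qed
  ultimately have "emeasure lborel {t \<in> {0..<2*pi}. g t \<le> 0} \<le> emeasure lborel A + emeasure lborel B"
    using sets by (metis emeasure_subadditive)
  also have "emeasure lborel A + emeasure lborel B = emeasure lborel (A \<union> B)"
  proof (rule plus_emeasure[OF sets])
    show "A \<inter> B = {}"
      using antipodal by (auto simp: A_def B_def) (metis not_le)
  qed
  also have "\<dots> \<le> emeasure lborel ({0..<pi} - ball t1 e)"
  proof (rule emeasure_mono)
    have "A \<inter> P = {}" "B \<inter> P = {}" "A \<subseteq> {0..<pi}" "B \<subseteq> {0..<pi}"
      by (auto simp: A_def B_def P_def)
    then show "A \<union> B \<subseteq> {0..<pi} - ball t1 e" using e(2) by blast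
  qed simp
  also have "emeasure lborel ({0..<pi} - ball t1 e) = ennreal pi - emeasure lborel (ball t1 e)"
  proof (subst emeasure_Diff)
    show "ball t1 e \<subseteq> {0..<pi}" using e(2) by (force dest: subsetD)
  qed (simp_all add: ball)
  also have "\<dots> < ennreal pi"
    unfolding ball using e(1) by (simp add: ennreal_minus ennreal_lessI)
  finally show ?thesis .
qed

text \<open>In the angular parametrisation antipodal points differ by the shift \<open>pi\<close>,
  and the factor \<open>r\<close> turns the bound \<open>pi\<close> into half of the
  circumference.\<close>

lemma circle_antipodal_free:
  fixes f :: "real^2 \<Rightarrow> real"
  assumes "r > 0" and f: "continuous_on (sphere x r) f"
    and antipodal: "\<And>v. norm v = 1 \<Longrightarrow> f (x + r *\<^sub>R v) > m \<or> f (x - r *\<^sub>R v) > m"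
  shows "emeasure (arclength_measure x r) {s \<in> sphere x r. f s \<le> m}
    < emeasure (arclength_measure x r) (sphere x r) / 2"
proof -
  have r0: "r \<ge> 0" using assms(1) by simp
  let ?c = "circle_param x r"
  define e :: "real \<Rightarrow> real^2" where "e t = vector [cos t, sin t]" for t
  have c: "?c t = x + r *\<^sub>R e t" for t by (simp add: circle_param_def e_def)
  have e: "e (t + pi) = - e t" "e (t + 2 * pi) = e t" for t
    by (auto simp: e_def vec_eq_iff forall_2)
  have en: "norm (e t) = 1" for t
    by (simp add: e_def norm_vec_def L2_set_def sum_2)
  note [measurable] = measurable_arclength[OF f]
  have "{s \<in> space (arclength_measure x r). f s \<le> m} \<in> sets (arclength_measure x r)"
    by measurable
  then have "{s \<in> sphere x r. f s \<le> m} \<in> sets (arclength_measure x r)" by simp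
  from emeasure_arclength[OF r0 this]
  have "emeasure (arclength_measure x r) {s \<in> sphere x r. f s \<le> m}
      = ennreal r * emeasure lborel {t \<in> {0..<2*pi}. f (?c t) - m \<le> 0}"
    using circle_param_in_sphere[OF r0] by simp
  also have "\<dots> < ennreal r * ennreal pi"
  proof (rule ennreal_mult_strict_left_mono)
    show "emeasure lborel {t \<in> {0..<2*pi}. f (?c t) - m \<le> 0} < ennreal pi"
    proof (rule emeasure_antipodal_free)
      show "continuous_on UNIV (\<lambda>t. f (?c t) - m)"
        by (intro continuous_intros continuous_on_compose2[OF f continuous_circle_param])
          (use circle_param_in_sphere[OF r0] in blast)
      show "f (?c (t + 2 * pi)) - m = f (?c t) - m" for t
        by (simp add: c e)
      show "f (?c t) - m > 0 \<or> f (?c (t + pi)) - m > 0" for t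
        using antipodal[OF en[of t]] by (simp add: c e)
    qed
  qed (use assms(1) in auto)
  also have "ennreal r * ennreal pi = emeasure (arclength_measure x r) (sphere x r) / 2"
    using r0 emeasure_arclength_sphere[OF r0]
    by (simp add: divide_ennreal[of _ 2, simplified] ennreal_mult'[symmetric] mult_ac)
  finally show ?thesis .
qed

section \<open>From medians on circles to viscosity solutions\<close>

text \<open>The hypothesis is the median inequality for the sublevel set alone. For
  \<open>- u\<close> it becomes the inequality for the superlevel set, so one lemma serves both
  halves of the final result.\<close>

lemma viscosity_supersolution_of_half_circles:
  fixes u :: "real^2 \<Rightarrow> real"
  assumes "open \<Omega>" and u: "continuous_on \<Omega> u"
    and half: "\<And>x. x \<in> \<Omega> \<Longrightarrow> \<exists>R>0. \<forall>r. 0 < r \<and> r \<le> R \<and> sphere x r \<subseteq> \<Omega> \<longrightarrow>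
      emeasure (arclength_measure x r) (sphere x r) / 2
        \<le> emeasure (arclength_measure x r) {s \<in> sphere x r. u s \<le> u x}"
  shows "viscosity_supersolution \<Omega> u"
  unfolding viscosity_supersolution_def
proof (intro conjI u ballI allI impI; elim conjE)
  fix x \<phi>
  assume x: "x \<in> \<Omega>" and \<phi>: "Ck_on 2 \<phi> \<Omega>" "u x = \<phi> x" and below: "\<forall>y\<in>\<Omega>. y \<noteq> x \<longrightarrow> u y > \<phi> y"
    and G: "gradient \<phi> x \<noteq> 0"
  show "- laplacian1 \<phi> x \<ge> 0"
  proof (rule ccontr)
    assume "\<not> ?thesis"
    then have "laplacian1 \<phi> x > 0" by simp
    from no_antipodal_sublevel[OF \<phi>(1) \<open>open \<Omega>\<close> x G this] obtain e where e: "e > 0"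
      "\<And>r v. \<lbrakk>0 < r; r < e; norm v = 1\<rbrakk> \<Longrightarrow> \<phi> x \<le> \<phi> (x + r *\<^sub>R v) \<or> \<phi> x \<le> \<phi> (x - r *\<^sub>R v)"
      by blast
    obtain R where R: "R > 0" "\<forall>r. 0 < r \<and> r \<le> R \<and> sphere x r \<subseteq> \<Omega> \<longrightarrow>
      emeasure (arclength_measure x r) (sphere x r) / 2
        \<le> emeasure (arclength_measure x r) {s \<in> sphere x r. u s \<le> u x}"
      using half[OF x] by blast
    obtain d where d: "d > 0" "cball x d \<subseteq> \<Omega>"
      using \<open>open \<Omega>\<close> x open_contains_cball by blast
    \<comment> \<open>\<open>e / 2\<close> ensures \<open>r < e\<close> strictly, and
      \<open>d\<close> places the circle in \<open>\<Omega>\<close>.\<close>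
    define r where "r = min (e / 2) (min R d)"
    have r: "r > 0" "r < e" "r \<le> R" "r \<le> d" using e R d by (auto simp: r_def)
    have sub: "sphere x r \<subseteq> \<Omega>" using d(2) r(4) by auto
    \<comment> \<open>Contact is strict away from \<open>x\<close>, so the weak inequality for
      \<open>\<phi>\<close> at one of the two ends becomes a strict one for
      \<open>u\<close>.\<close>
    have "u (x + r *\<^sub>R v) > u x \<or> u (x - r *\<^sub>R v) > u x" if v: "norm v = 1" for v
    proof -
      have "x + r *\<^sub>R v \<in> \<Omega>" "x - r *\<^sub>R v \<in> \<Omega>"
        using sub v r(1) by (auto simp: subset_iff dist_norm)
      moreover have "v \<noteq> 0" using v by auto
      ultimately have "u (x + r *\<^sub>R v) > \<phi> (x + r *\<^sub>R v)" "u (x - r *\<^sub>R v) > \<phi> (x - r *\<^sub>R v)"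
        using below r(1) by auto
      then show ?thesis using e(2)[OF r(1,2) v] \<phi>(2) by auto
    qed
    from circle_antipodal_free[OF r(1) continuous_on_subset[OF u sub] this]
    show False using R(2) r sub by (meson not_le)
  qed
qed

theorem theorem3:
  fixes \<Omega> :: "(real^2) set" and u :: "real^2 \<Rightarrow> real"
  assumes "open \<Omega>" and "connected \<Omega>" and "\<Omega> \<noteq> {}"
    and "smooth_boundary \<Omega>"
    and "continuous_on \<Omega> u"
    and "local_median_value_property \<Omega> u"
  shows "one_harmonic_viscosity \<Omega> u"
proof -
  obtain R where R: "\<And>x. x \<in> \<Omega> \<Longrightarrow> 0 < R x"
    "\<And>x r. \<lbrakk>x \<in> \<Omega>; 0 < r; r \<le> R x; sphere x r \<subseteq> \<Omega>\<rbrakk> \<Longrightarrow> u x = circle_median u x r"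
    using assms(6) unfolding local_median_value_property_def by blast
  \<comment> \<open>Existence and uniqueness of the median of a continuous function on a circle turn
    the definite description in \<open>circle_median\<close> into the two measure
    inequalities.\<close>
  have med: "is_median (arclength_measure x r) (sphere x r) u (u x)"
    if "x \<in> \<Omega>" "0 < r" "r \<le> R x" "sphere x r \<subseteq> \<Omega>" for x r
    using R(2)[OF that] circle_median_eq_iff[OF that(2) continuous_on_subset[OF assms(5) that(4)]]
    by metis
  have "viscosity_supersolution \<Omega> u"
  proof (rule viscosity_supersolution_of_half_circles[OF assms(1,5)], intro exI conjI allI impI)
    fix x r assume "x \<in> \<Omega>" "0 < r \<and> r \<le> R x \<and> sphere x r \<subseteq> \<Omega>"
    then show "emeasure (arclength_measure x r) (sphere x r) / 2
        \<le> emeasure (arclength_measure x r) {s \<in> sphere x r. u s \<le> u x}"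
      using med[of x r] unfolding is_median_def by blast
  qed (rule R(1))
  \<comment> \<open>Since \<open>- u s \<le> - u x\<close> means \<open>u s \<ge> u x\<close>, this
    uses the other median inequality.\<close>
  moreover have "viscosity_supersolution \<Omega> (\<lambda>x. - u x)"
  proof (rule viscosity_supersolution_of_half_circles[OF assms(1) continuous_on_minus[OF assms(5)]],
      intro exI conjI allI impI)
    fix x r assume "x \<in> \<Omega>" "0 < r \<and> r \<le> R x \<and> sphere x r \<subseteq> \<Omega>"
    then show "emeasure (arclength_measure x r) (sphere x r) / 2
        \<le> emeasure (arclength_measure x r) {s \<in> sphere x r. - u s \<le> - u x}"
      using med[of x r] unfolding is_median_def neg_le_iff_le by blast
  qed (rule R(1))
  ultimately show ?thesis
    by (simp add: one_harmonic_viscosity_def viscosity_subsolution_def)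
qed

end
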